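(* A surjective morphism $f\colon A\to B$ of racks (or of quandles) is a covering if and only if every $f$-horn retracts (or equivalently, if and only if every $f$-horn closes into a disk).
   Context: A rack is a set $X$ with two binary operations $\triangleleft,\triangleleft^{-1}$ such that $(x\triangleleft y)\triangleleft^{-1}y = x = (x\triangleleft^{-1}y)\triangleleft y$ and $(x\triangleleft y)\triangleleft z=(x\triangleleft z)\triangleleft(y\triangleleft z)$; a quandle is a rack with $x\triangleleft x=x$. Write $\triangleleft^1=\triangleleft$. Covering: a surjective morphism $f\colon A\to B$ such that $(x\triangleleft a)\triangleleft^{-1}b=x$ for all $x,a,b\in A$ with $f(a)=f(b)$. An $f$-horn $M=(x,(a_i,b_i,\delta_i)_{1\le i\le n})$ consists of an element $x\in A$, $n\in\mathbb N$, pairs $(a_i,b_i)\in A\times A$ with $f(a_i)=f(b_i)$, and $\delta_i\in\{-1,1\}$. Its endpoints are $a^M=(\cdots(x\triangleleft^{\delta_1}a_1)\cdots)\triangleleft^{\delta_n}a_n$ and $b^M=(\cdots(x\triangleleft^{\delta_1}b_1)\cdots)\triangleleft^{\delta_n}b_n$. The horn $M$ closes (into a disk) if $a^M=b^M$. It retracts if for each $1\le k\le n$ the truncated horn $M_{\le k}=(x,(a_i,b_i,\delta_i)_{1\le i\le k})$ closes. *)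

theory Defs
  imports "HOL-Algebra.Congruence" "HOL-Library.FuncSet"
begin

record 'a rack_struct = "'a partial_object" +
  rop  :: "'a \<Rightarrow> 'a \<Rightarrow> 'a"  (infixl \<open>\<triangleleft>\<index>\<close> 70)
  rinv :: "'a \<Rightarrow> 'a \<Rightarrow> 'a"  (infixl \<open>\<triangleleft>\<^sup>-\<index>\<close> 70)

locale rack =
  fixes X (structure)
  assumes rop_closed: "\<lbrakk>x \<in> carrier X; y \<in> carrier X\<rbrakk> \<Longrightarrow> x \<triangleleft> y \<in> carrier X"
    and rinv_closed: "\<lbrakk>x \<in> carrier X; y \<in> carrier X\<rbrakk> \<Longrightarrow> x \<triangleleft>\<^sup>- y \<in> carrier X"
    and rinv_rop: "\<lbrakk>x \<in> carrier X; y \<in> carrier X\<rbrakk> \<Longrightarrow> (x \<triangleleft> y) \<triangleleft>\<^sup>- y = x"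
    and rop_rinv: "\<lbrakk>x \<in> carrier X; y \<in> carrier X\<rbrakk> \<Longrightarrow> (x \<triangleleft>\<^sup>- y) \<triangleleft> y = x"
    and self_distrib: "\<lbrakk>x \<in> carrier X; y \<in> carrier X; z \<in> carrier X\<rbrakk>
      \<Longrightarrow> (x \<triangleleft> y) \<triangleleft> z = (x \<triangleleft> z) \<triangleleft> (y \<triangleleft> z)"

locale quandle = rack +
  assumes idem: "x \<in> carrier X \<Longrightarrow> x \<triangleleft> x = x"

definition rack_hom :: "('a, 'm) rack_struct_scheme \<Rightarrow> ('b, 'n) rack_struct_scheme \<Rightarrow> ('a \<Rightarrow> 'b) set"
  where "rack_hom A B = {f \<in> carrier A \<rightarrow> carrier B.
    (\<forall>x \<in> carrier A. \<forall>y \<in> carrier A.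
      f (x \<triangleleft>\<^bsub>A\<^esub> y) = f x \<triangleleft>\<^bsub>B\<^esub> f y \<and> f (x \<triangleleft>\<^sup>-\<^bsub>A\<^esub> y) = f x \<triangleleft>\<^sup>-\<^bsub>B\<^esub> f y)}"

definition surj_rack_hom :: "('a, 'm) rack_struct_scheme \<Rightarrow> ('b, 'n) rack_struct_scheme \<Rightarrow> ('a \<Rightarrow> 'b) \<Rightarrow> bool"
  where "surj_rack_hom A B f \<longleftrightarrow> f \<in> rack_hom A B \<and> f ` carrier A = carrier B"

definition covering :: "('a, 'm) rack_struct_scheme \<Rightarrow> ('b, 'n) rack_struct_scheme \<Rightarrow> ('a \<Rightarrow> 'b) \<Rightarrow> bool"
  where "covering A B f \<longleftrightarrow> surj_rack_hom A B f \<and>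
    (\<forall>x \<in> carrier A. \<forall>a \<in> carrier A. \<forall>b \<in> carrier A.
      f a = f b \<longrightarrow> (x \<triangleleft>\<^bsub>A\<^esub> a) \<triangleleft>\<^sup>-\<^bsub>A\<^esub> b = x)"

text \<open>The operation $\triangleleft^\delta$. It is only used for $\delta = 1$ and $\delta = -1$.\<close>

definition rop_exp :: "('a, 'm) rack_struct_scheme \<Rightarrow> int \<Rightarrow> 'a \<Rightarrow> 'a \<Rightarrow> 'a"
  where "rop_exp A \<delta> x y = (if \<delta> = 1 then x \<triangleleft>\<^bsub>A\<^esub> y else x \<triangleleft>\<^sup>-\<^bsub>A\<^esub> y)"

text \<open>A horn $(x, (a_i, b_i, \delta_i)_{1 \le i \le n})$ is stored as $x$ together with the list
  of its $n$ triples; $n = 0$ is allowed.\<close>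

type_synonym 'a horn = "'a \<times> ('a \<times> 'a \<times> int) list"

definition is_horn :: "('a, 'm) rack_struct_scheme \<Rightarrow> ('a \<Rightarrow> 'b) \<Rightarrow> 'a horn \<Rightarrow> bool"
  where "is_horn A f M \<longleftrightarrow> fst M \<in> carrier A \<and>
    (\<forall>(a, b, \<delta>) \<in> set (snd M). a \<in> carrier A \<and> b \<in> carrier A \<and> f a = f b \<and> \<delta> \<in> {-1, 1})"

definition horn_end_a :: "('a, 'm) rack_struct_scheme \<Rightarrow> 'a horn \<Rightarrow> 'a"
  where "horn_end_a A M = foldl (\<lambda>y (a, b, \<delta>). rop_exp A \<delta> y a) (fst M) (snd M)"

definition horn_end_b :: "('a, 'm) rack_struct_scheme \<Rightarrow> 'a horn \<Rightarrow> 'a"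
  where "horn_end_b A M = foldl (\<lambda>y (a, b, \<delta>). rop_exp A \<delta> y b) (fst M) (snd M)"

definition horn_closes :: "('a, 'm) rack_struct_scheme \<Rightarrow> 'a horn \<Rightarrow> bool"
  where "horn_closes A M \<longleftrightarrow> horn_end_a A M = horn_end_b A M"

definition horn_truncate :: "nat \<Rightarrow> 'a horn \<Rightarrow> 'a horn"
  where "horn_truncate k M = (fst M, take k (snd M))"

definition horn_retracts :: "('a, 'm) rack_struct_scheme \<Rightarrow> 'a horn \<Rightarrow> bool"
  where "horn_retracts A M \<longleftrightarrow> (\<forall>k \<in> {1..length (snd M)}. horn_closes A (horn_truncate k M))"

end

theory Submission
  imports Defs
begin

text \<open>
  Multiplying the covering identity \<open>(x \<triangleleft> a) \<triangleleft>\<^sup>- b = x\<close> by \<open>b\<close> on the right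
  turns it into \<open>x \<triangleleft> a = x \<triangleleft> b\<close>: a surjective morphism is a covering exactly when any two
  points of the same fibre act in the same way (\<open>covering_iff_fibre_action\<close>). The inverse
  actions then agree as well. Hence, over a covering, the two legs of a horn coincide step by step,
  and every horn closes (\<open>covering_imp_horn_closes\<close>). Truncations of horns are horns, so if all
  horns close then all retract (\<open>all_close_imp_horn_retracts\<close>). Conversely, a horn of length
  one with exponent \<open>1\<close> that retracts is the equation \<open>x \<triangleleft> a = x \<triangleleft> b\<close>, so if all horns
  retract then \<open>f\<close> is a covering (\<open>all_retract_imp_covering\<close>). These three implications form a
  cycle.
\<close>

lemma (in rack) covering_iff_fibre_action:
  assumes "surj_rack_hom X B f"
  shows "covering X B f \<longleftrightarrow>
    (\<forall>x \<in> carrier X. \<forall>a \<in> carrier X. \<forall>b \<in> carrier X. f a = f b \<longrightarrow> x \<triangleleft> a = x \<triangleleft> b)"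
proof -
  have "(x \<triangleleft> a) \<triangleleft>\<^sup>- b = x \<longleftrightarrow> x \<triangleleft> a = x \<triangleleft> b"
    if "x \<in> carrier X" "a \<in> carrier X" "b \<in> carrier X" for x a b
    using that rop_rinv[of "x \<triangleleft> a" b] rinv_rop[of x b] by (auto simp: rop_closed)
  then show ?thesis
    using assms by (auto simp: covering_def)
qed

lemma (in rack) covering_rop_exp_eq:
  assumes "covering X B f"
    and "x \<in> carrier X" "a \<in> carrier X" "b \<in> carrier X" "f a = f b"
  shows "rop_exp X \<delta> x a = rop_exp X \<delta> x b"
proof -
  have surj: "surj_rack_hom X B f"
    using assms(1) by (simp add: covering_def)
  have act: "y \<triangleleft> a = y \<triangleleft> b" if "y \<in> carrier X" for y
    using covering_iff_fibre_action[OF surj] assms that by blast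
  \<comment> \<open>The element \<open>x \<triangleleft>\<^sup>- b\<close> is sent to \<open>x\<close> by \<open>b\<close>, hence also by \<open>a\<close>, which characterizes
    \<open>x \<triangleleft>\<^sup>- a\<close>.\<close>
  have "(x \<triangleleft>\<^sup>- b) \<triangleleft> a = x"
    using act[of "x \<triangleleft>\<^sup>- b"] assms(2-4) by (simp add: rinv_closed rop_rinv)
  then have "x \<triangleleft>\<^sup>- a = x \<triangleleft>\<^sup>- b"
    using rinv_rop[of "x \<triangleleft>\<^sup>- b" a] assms(2-4) by (simp add: rinv_closed)
  then show ?thesis
    using act[OF assms(2)] by (simp add: rop_exp_def)
qed

text \<open>
  The first step moves the apex to one common point, which is the apex of the remaining horn;
  this is why the induction runs over all apices at once.
\<close>

lemma (in rack) covering_imp_horn_closes: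
  assumes cov: "covering X B f" and horn: "is_horn X f M"
  shows "horn_closes X M"
proof -
  have "horn_closes X (x, ts)" if "is_horn X f (x, ts)" for x ts
    using that
  proof (induction ts arbitrary: x)
    case Nil
    then show ?case
      by (simp add: horn_closes_def horn_end_a_def horn_end_b_def)
  next
    case (Cons t ts)
    obtain a b \<delta> where t: "t = (a, b, \<delta>)"
      by (cases t)
    have eq: "rop_exp X \<delta> x a = rop_exp X \<delta> x b"
      using Cons.prems t by (intro covering_rop_exp_eq[OF cov]) (auto simp: is_horn_def)
    have "is_horn X f (rop_exp X \<delta> x a, ts)"
      using Cons.prems t by (auto simp: is_horn_def rop_exp_def rop_closed rinv_closed)
    from Cons.IH[OF this] show ?case
      by (simp add: horn_closes_def horn_end_a_def horn_end_b_def t eq)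
  qed
  then show ?thesis
    using horn by (cases M) simp
qed

lemma is_horn_truncate: "is_horn A f M \<Longrightarrow> is_horn A f (horn_truncate k M)"
  by (auto simp: is_horn_def horn_truncate_def dest: in_set_takeD)

lemma all_close_imp_horn_retracts:
  assumes "\<And>M. is_horn A f M \<Longrightarrow> horn_closes A M" and "is_horn A f M"
  shows "horn_retracts A M"
  unfolding horn_retracts_def
  by (intro ballI assms(1) is_horn_truncate assms(2))

lemma (in rack) all_retract_imp_covering:
  assumes surj: "surj_rack_hom X B f"
    and retract: "\<And>M. is_horn X f M \<Longrightarrow> horn_retracts X M"
  shows "covering X B f"
proof -
  have "x \<triangleleft> a = x \<triangleleft> b"
    if "x \<in> carrier X" "a \<in> carrier X" "b \<in> carrier X" "f a = f b" for x a b
    using retract[of "(x, [(a, b, 1)])"] that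
    by (simp add: is_horn_def horn_retracts_def horn_truncate_def horn_closes_def
        horn_end_a_def horn_end_b_def rop_exp_def)
  then show ?thesis
    unfolding covering_iff_fibre_action[OF surj] by blast
qed

theorem corollary3p1p2p1:
  fixes A :: "('a, 'm) rack_struct_scheme"
    and B :: "('b, 'n) rack_struct_scheme"
    and f :: "'a \<Rightarrow> 'b"
  assumes "(rack A \<and> rack B) \<or> (quandle A \<and> quandle B)"
    and "surj_rack_hom A B f"
  shows "(covering A B f \<longleftrightarrow> (\<forall>M. is_horn A f M \<longrightarrow> horn_retracts A M)) \<and>
         (covering A B f \<longleftrightarrow> (\<forall>M. is_horn A f M \<longrightarrow> horn_closes A M))"
proof -
  interpret rack A
    using assms(1) quandle.axioms(1) by blast
  show ?thesis
    using covering_imp_horn_closes[of B f] all_close_imp_horn_retracts[of A f]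
      all_retract_imp_covering[OF assms(2)]
    by blast
qed

end
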